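(* Let $H$ be a graded connected Hopf algebra over $\Bbbk$ with finite-dimensional homogeneous components, and let $S$ be its antipode. Then the eigenvalues of $S$ are $\pm1$; that is, every eigenvalue of $S$ is equal to $1$ or $-1$.
   Context: $\Bbbk$ is a field of characteristic zero. A graded connected Hopf algebra is a bialgebra $H$ with product $\mu$, coproduct $\Delta$, unit $1$, counit $\varepsilon$ and a decomposition $H=\bigoplus_{m\ge 0}H_m$ such that $\mu(H_p\otimes H_q)\subseteq H_{p+q}$, $\Delta(H_m)\subseteq\bigoplus_{p+q=m}H_p\otimes H_q$, $1\in H_0$, $\varepsilon(H_m)=0$ for $m>0$, and $\dim H_0=1$. It automatically has an antipode $S$, and $S(H_m)\subseteq H_m$ for all $m$. Eigenvalues refer to the restrictions of $S$ to the finite-dimensional spaces $H_m$ (i.e. roots of their characteristic polynomials). *)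

theory Defs
  imports
    "HOL-Library.Poly_Mapping"
    "HOL-Algebra.Algebraic_Closure_Type"
    "Jordan_Normal_Form.Char_Poly"
begin

section \<open>Free vector spaces\<close>

text \<open>The free vector space on \<open>'x\<close> is \<open>'x \<Rightarrow>\<^sub>0 'k\<close>.\<close>

abbreviation gen :: "'x \<Rightarrow> ('x \<Rightarrow>\<^sub>0 'k::field)" where
  "gen x \<equiv> Poly_Mapping.single x 1"

definition free_scale :: "'k::field \<Rightarrow> ('x \<Rightarrow>\<^sub>0 'k) \<Rightarrow> ('x \<Rightarrow>\<^sub>0 'k)" where
  "free_scale c = Poly_Mapping.map ((*) c)"

lemma lookup_free_scale [simp]: "Poly_Mapping.lookup (free_scale c u) x = c * Poly_Mapping.lookup u x"
  by (simp add: free_scale_def map.rep_eq when_def)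

locale kspace = vector_space scale
  for scale :: "'k::field \<Rightarrow> 'v::ab_group_add \<Rightarrow> 'v"

interpretation free: kspace free_scale
  by unfold_locales (auto intro!: poly_mapping_eqI simp: lookup_add algebra_simps)

definition free_extend ::
    "('k::field \<Rightarrow> 'v \<Rightarrow> 'v::ab_group_add) \<Rightarrow> ('x \<Rightarrow> 'v) \<Rightarrow> ('x \<Rightarrow>\<^sub>0 'k) \<Rightarrow> 'v" where
  "free_extend s f u = (\<Sum>x\<in>Poly_Mapping.keys u. s (Poly_Mapping.lookup u x) (f x))"

context kspace
begin

lemma free_extend_superset:
  assumes "finite I" "Poly_Mapping.keys u \<subseteq> I"
  shows "free_extend scale f u = (\<Sum>x\<in>I. scale (Poly_Mapping.lookup u x) (f x))"
  unfolding free_extend_def using assms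
  by (intro sum.mono_neutral_left) (auto simp: in_keys_iff)

lemma free_extend_add: "free_extend scale f (u + v) = free_extend scale f u + free_extend scale f v"
proof -
  let ?I = "Poly_Mapping.keys u \<union> Poly_Mapping.keys v"
  have "Poly_Mapping.keys (u + v) \<subseteq> ?I" by (rule Poly_Mapping.keys_add)
  then show ?thesis
    by (simp add: free_extend_superset[of ?I] lookup_add scale_left_distrib sum.distrib)
qed

lemma free_extend_scale: "free_extend scale f (free_scale c u) = scale c (free_extend scale f u)"
proof -
  have "Poly_Mapping.keys (free_scale c u) \<subseteq> Poly_Mapping.keys u"
    by (auto simp: in_keys_iff)
  then show ?thesis
    by (simp add: free_extend_superset[of "Poly_Mapping.keys u"] scale_sum_right)
qed

lemma free_extend_gen [simp]: "free_extend scale f (gen x) = f x"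
  by (simp add: free_extend_def)

lemma linear_free_extend: "Vector_Spaces.linear free_scale scale (free_extend scale f)"
  by (auto intro!: Vector_Spaces.linear.intro module_hom.intro module_hom_axioms.intro
      free_extend_add free_extend_scale vector_space_axioms free.vector_space_axioms
      module_axioms free.module_axioms)

lemma free_extend_diff: "free_extend scale f (u - v) = free_extend scale f u - free_extend scale f v"
  using free_extend_add[of f "u - v" v] by simp

lemma free_extend_fun_diff:
  "free_extend scale (\<lambda>x. f x - g x) u = free_extend scale f u - free_extend scale g u"
  by (simp add: free_extend_def scale_right_diff_distrib sum_subtractf)

lemma free_extend_fun_scale:
  "free_extend scale (\<lambda>x. scale c (f x)) u = scale c (free_extend scale f u)"
  by (simp add: free_extend_def scale_sum_right mult.commute)

lemma free_extend_mem: "subspace N \<Longrightarrow> (\<And>x. f x \<in> N) \<Longrightarrow> free_extend scale f u \<in> N"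
  by (auto simp: free_extend_def intro!: subspace_sum subspace_scale)

lemma free_extend_zero [simp]: "free_extend scale f 0 = 0"
  by (simp add: free_extend_def)

end

section \<open>Tensor products\<close>

text \<open>
  The spaces \<open>H \<otimes> H\<close> and \<open>H \<otimes> H \<otimes> H\<close> are the quotients of the free vector spaces on
  pairs and triples by the relations expressing linearity in each slot. A slot is given by the
  maps \<open>e\<close> that insert an element in this position and fixed elements in the other ones. Elements
  of the quotients are cosets, and the operations on them are defined through representatives.
\<close>

context kspace
begin

definition slot_relations :: "('v \<Rightarrow> 'x) set \<Rightarrow> ('x \<Rightarrow>\<^sub>0 'k) set" where
  "slot_relations E =
     {gen (e (x + y)) - gen (e x) - gen (e y) | e x y. e \<in> E} \<union>
     {gen (e (scale c x)) - free_scale c (gen (e x)) | e c x. e \<in> E}"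

definition tensor2_null :: "('v \<times> 'v \<Rightarrow>\<^sub>0 'k) set" where
  "tensor2_null = free.span (slot_relations
     ({\<lambda>x. (x, y) | y. True} \<union> {\<lambda>y. (x, y) | x. True}))"

definition tensor3_null :: "('v \<times> 'v \<times> 'v \<Rightarrow>\<^sub>0 'k) set" where
  "tensor3_null = free.span (slot_relations
     ({\<lambda>x. (x, y, z) | y z. True} \<union> {\<lambda>y. (x, y, z) | x z. True} \<union> {\<lambda>z. (x, y, z) | x y. True}))"

definition tensor2 :: "('v \<times> 'v \<Rightarrow>\<^sub>0 'k) \<Rightarrow> ('v \<times> 'v \<Rightarrow>\<^sub>0 'k) set" where
  "tensor2 u = {v. v - u \<in> tensor2_null}"

definition tensor3 :: "('v \<times> 'v \<times> 'v \<Rightarrow>\<^sub>0 'k) \<Rightarrow> ('v \<times> 'v \<times> 'v \<Rightarrow>\<^sub>0 'k) set" where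
  "tensor3 u = {v. v - u \<in> tensor3_null}"

definition tensor2_add ::
    "('v \<times> 'v \<Rightarrow>\<^sub>0 'k) set \<Rightarrow> ('v \<times> 'v \<Rightarrow>\<^sub>0 'k) set \<Rightarrow> ('v \<times> 'v \<Rightarrow>\<^sub>0 'k) set" where
  "tensor2_add A B = (\<Union>u\<in>A. \<Union>v\<in>B. tensor2 (u + v))"

definition tensor2_scale :: "'k \<Rightarrow> ('v \<times> 'v \<Rightarrow>\<^sub>0 'k) set \<Rightarrow> ('v \<times> 'v \<Rightarrow>\<^sub>0 'k) set" where
  "tensor2_scale c A = (\<Union>u\<in>A. tensor2 (free_scale c u))"

text \<open>The linear map \<open>H \<otimes> H \<rightarrow> H\<close> induced by a bilinear map \<open>\<beta>\<close>; the image below is then a singleton.\<close>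

definition tensor2_lift :: "('v \<Rightarrow> 'v \<Rightarrow> 'v) \<Rightarrow> ('v \<times> 'v \<Rightarrow>\<^sub>0 'k) set \<Rightarrow> 'v" where
  "tensor2_lift \<beta> A = the_elem (free_extend scale (\<lambda>(x, y). \<beta> x y) ` A)"

text \<open>
  The maps \<open>D \<otimes> id\<close> and \<open>id \<otimes> D\<close> for a linear map \<open>D : H \<rightarrow> H \<otimes> H\<close>, where \<open>d\<close> ranges over the
  choices of representatives of the values of \<open>D\<close>.
\<close>

definition left_extend ::
    "('v \<Rightarrow> 'v \<times> 'v \<Rightarrow>\<^sub>0 'k) \<Rightarrow> ('v \<times> 'v \<Rightarrow>\<^sub>0 'k) \<Rightarrow> ('v \<times> 'v \<times> 'v \<Rightarrow>\<^sub>0 'k)" where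
  "left_extend d = free_extend free_scale
     (\<lambda>(x, y). free_extend free_scale (\<lambda>(p, q). gen (p, q, y)) (d x))"

definition right_extend ::
    "('v \<Rightarrow> 'v \<times> 'v \<Rightarrow>\<^sub>0 'k) \<Rightarrow> ('v \<times> 'v \<Rightarrow>\<^sub>0 'k) \<Rightarrow> ('v \<times> 'v \<times> 'v \<Rightarrow>\<^sub>0 'k)" where
  "right_extend d = free_extend free_scale
     (\<lambda>(x, y). free_extend free_scale (\<lambda>(p, q). gen (x, p, q)) (d y))"

definition tensor_id_right ::
    "('v \<Rightarrow> ('v \<times> 'v \<Rightarrow>\<^sub>0 'k) set) \<Rightarrow> ('v \<times> 'v \<Rightarrow>\<^sub>0 'k) set \<Rightarrow> ('v \<times> 'v \<times> 'v \<Rightarrow>\<^sub>0 'k) set" where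
  "tensor_id_right D A = (\<Union>u\<in>A. \<Union>d\<in>{d. \<forall>x. d x \<in> D x}. tensor3 (left_extend d u))"

definition tensor_id_left ::
    "('v \<Rightarrow> ('v \<times> 'v \<Rightarrow>\<^sub>0 'k) set) \<Rightarrow> ('v \<times> 'v \<Rightarrow>\<^sub>0 'k) set \<Rightarrow> ('v \<times> 'v \<times> 'v \<Rightarrow>\<^sub>0 'k) set" where
  "tensor_id_left D A = (\<Union>u\<in>A. \<Union>d\<in>{d. \<forall>x. d x \<in> D x}. tensor3 (right_extend d u))"

definition tensor2_linear :: "('v \<Rightarrow> ('v \<times> 'v \<Rightarrow>\<^sub>0 'k) set) \<Rightarrow> bool" where
  "tensor2_linear D \<longleftrightarrow>
     (\<forall>x. D x \<in> range tensor2) \<and>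
     (\<forall>x y. D (x + y) = tensor2_add (D x) (D y)) \<and>
     (\<forall>c x. D (scale c x) = tensor2_scale c (D x))"

lemma free_extend_slot_relations:
  assumes "kspace s" and N: "module.subspace s N"
    and add: "\<And>e x y. e \<in> E \<Longrightarrow> f (e (x + y)) - f (e x) - f (e y) \<in> N"
    and scal: "\<And>e c x. e \<in> E \<Longrightarrow> f (e (scale c x)) - s c (f (e x)) \<in> N"
    and w: "w \<in> free.span (slot_relations E)"
  shows "free_extend s f w \<in> N"
proof -
  interpret t: kspace s by fact
  show ?thesis using w
  proof (induction rule: free.span_induct_alt)
    case base
    then show ?case using N by (simp add: t.subspace_0)
  next
    case (step c x y)
    have "free_extend s f x \<in> N"
      using step(1) add scal unfolding slot_relations_def
      by (auto simp: t.free_extend_diff t.free_extend_scale)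
    then show ?case
      using N step by (simp add: t.free_extend_add t.free_extend_scale t.subspace_add t.subspace_scale)
  qed
qed

lemma slot_relations_span:
  assumes "e \<in> E"
  shows "gen (e (x + y)) - gen (e x) - gen (e y) \<in> free.span (slot_relations E)"
    and "gen (e (scale c x)) - free_scale c (gen (e x)) \<in> free.span (slot_relations E)"
  using assms unfolding slot_relations_def by (blast intro: free.span_base)+

lemma tensor2_relations:
  "gen (x + x', y) - gen (x, y) - gen (x', y) \<in> tensor2_null"
  "gen (y, x + x') - gen (y, x) - gen (y, x') \<in> tensor2_null"
  "gen (scale c x, y) - free_scale c (gen (x, y)) \<in> tensor2_null"
  "gen (y, scale c x) - free_scale c (gen (y, x)) \<in> tensor2_null"
  unfolding tensor2_null_def
  subgoal by (rule slot_relations_span(1)[where e = "\<lambda>x. (x, y)"]) blast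
  subgoal by (rule slot_relations_span(1)[where e = "\<lambda>x. (y, x)"]) blast
  subgoal by (rule slot_relations_span(2)[where e = "\<lambda>x. (x, y)"]) blast
  subgoal by (rule slot_relations_span(2)[where e = "\<lambda>x. (y, x)"]) blast
  done

lemma tensor3_relations:
  "gen (x + x', y, z) - gen (x, y, z) - gen (x', y, z) \<in> tensor3_null"
  "gen (y, x + x', z) - gen (y, x, z) - gen (y, x', z) \<in> tensor3_null"
  "gen (y, z, x + x') - gen (y, z, x) - gen (y, z, x') \<in> tensor3_null"
  "gen (scale c x, y, z) - free_scale c (gen (x, y, z)) \<in> tensor3_null"
  "gen (y, scale c x, z) - free_scale c (gen (y, x, z)) \<in> tensor3_null"
  "gen (y, z, scale c x) - free_scale c (gen (y, z, x)) \<in> tensor3_null"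
  unfolding tensor3_null_def
  subgoal by (rule slot_relations_span(1)[where e = "\<lambda>x. (x, y, z)"]) blast
  subgoal by (rule slot_relations_span(1)[where e = "\<lambda>x. (y, x, z)"]) blast
  subgoal by (rule slot_relations_span(1)[where e = "\<lambda>x. (y, z, x)"]) blast
  subgoal by (rule slot_relations_span(2)[where e = "\<lambda>x. (x, y, z)"]) blast
  subgoal by (rule slot_relations_span(2)[where e = "\<lambda>x. (y, x, z)"]) blast
  subgoal by (rule slot_relations_span(2)[where e = "\<lambda>x. (y, z, x)"]) blast
  done

lemma tensor2_eq_iff: "tensor2 u = tensor2 v \<longleftrightarrow> u - v \<in> tensor2_null"
proof
  assume "tensor2 u = tensor2 v"
  moreover have "u \<in> tensor2 u"
    by (simp add: tensor2_def tensor2_null_def free.span_zero)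
  ultimately show "u - v \<in> tensor2_null" by (simp add: tensor2_def)
next
  assume *: "u - v \<in> tensor2_null"
  have "w - u \<in> tensor2_null \<longleftrightarrow> w - v \<in> tensor2_null" for w
    using free.span_add_eq2[OF *[unfolded tensor2_null_def], of "w - u"]
    by (simp add: tensor2_null_def)
  then show "tensor2 u = tensor2 v" by (simp add: tensor2_def)
qed

lemma tensor3_eq_iff: "tensor3 u = tensor3 v \<longleftrightarrow> u - v \<in> tensor3_null"
proof
  assume "tensor3 u = tensor3 v"
  moreover have "u \<in> tensor3 u"
    by (simp add: tensor3_def tensor3_null_def free.span_zero)
  ultimately show "u - v \<in> tensor3_null" by (simp add: tensor3_def)
next
  assume *: "u - v \<in> tensor3_null"
  have "w - u \<in> tensor3_null \<longleftrightarrow> w - v \<in> tensor3_null" for w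
    using free.span_add_eq2[OF *[unfolded tensor3_null_def], of "w - u"]
    by (simp add: tensor3_null_def)
  then show "tensor3 u = tensor3 v" by (simp add: tensor3_def)
qed

lemma tensor2_self: "u \<in> tensor2 u"
  by (simp add: tensor2_def tensor2_null_def free.span_zero)

lemma mem_tensor2D: "v \<in> tensor2 u \<Longrightarrow> tensor2 v = tensor2 u"
  using tensor2_eq_iff[of v u] by (metis mem_Collect_eq tensor2_def)

lemma tensor2_add: "tensor2_add (tensor2 u) (tensor2 v) = tensor2 (u + v)"
proof -
  have "tensor2 (u' + v') = tensor2 (u + v)" if "u' \<in> tensor2 u" "v' \<in> tensor2 v" for u' v'
  proof -
    have "(u' - u) + (v' - v) \<in> tensor2_null"
      using that by (simp only: tensor2_def tensor2_null_def mem_Collect_eq free.span_add)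
    then show ?thesis by (simp add: tensor2_eq_iff algebra_simps)
  qed
  then show ?thesis unfolding tensor2_add_def using tensor2_self by blast
qed

lemma tensor2_scale: "tensor2_scale c (tensor2 u) = tensor2 (free_scale c u)"
proof -
  have "tensor2 (free_scale c u') = tensor2 (free_scale c u)" if "u' \<in> tensor2 u" for u'
  proof -
    have "free_scale c (u' - u) \<in> tensor2_null"
      using that by (simp only: tensor2_def tensor2_null_def mem_Collect_eq free.span_scale)
    then show ?thesis by (simp add: tensor2_eq_iff free.scale_right_diff_distrib)
  qed
  then show ?thesis unfolding tensor2_scale_def using tensor2_self by blast
qed

lemma tensor2_lift:
  assumes "\<And>y. Vector_Spaces.linear scale scale (\<lambda>x. \<beta> x y)"
    and "\<And>x. Vector_Spaces.linear scale scale (\<lambda>y. \<beta> x y)"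
  shows "tensor2_lift \<beta> (tensor2 u) = free_extend scale (\<lambda>(x, y). \<beta> x y) u"
proof -
  let ?g = "free_extend scale (\<lambda>(x, y). \<beta> x y)"
  have hom: "module_hom scale scale (\<lambda>x. \<beta> x y)" "module_hom scale scale (\<lambda>y. \<beta> x y)" for x y
    using assms by (auto simp: Vector_Spaces.linear_def)
  have "?g w \<in> {0}" if "w \<in> tensor2_null" for w
    by (rule free_extend_slot_relations[OF kspace_axioms subspace_single_0 _ _
          that[unfolded tensor2_null_def]])
      (auto simp: module_hom.add[OF hom(1)] module_hom.add[OF hom(2)]
        module_hom.scale[OF hom(1)] module_hom.scale[OF hom(2)])
  then have "?g (v - u) = 0" if "v \<in> tensor2 u" for v
    using that by (simp add: tensor2_def)
  then have "?g v = ?g u" if "v \<in> tensor2 u" for v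
    using that by (simp add: free_extend_diff)
  then have "?g ` tensor2 u = {?g u}"
    using tensor2_self[of u] by blast
  then show ?thesis by (simp add: tensor2_lift_def)
qed

lemma tensor_id_right:
  assumes D: "tensor2_linear D" and d: "\<And>x. d x \<in> D x"
  shows "tensor_id_right D (tensor2 u) = tensor3 (left_extend d u)"
proof -
  let ?g = "\<lambda>y. free_extend free_scale (\<lambda>(p, q). gen (p, q, y))"
  have N: "free.subspace tensor3_null" by (simp add: tensor3_null_def)
  have slot: "free_extend free_scale (\<lambda>(p, q). gen (p, q, y)) w \<in> tensor3_null" if "w \<in> tensor2_null" for w y
    by (rule free_extend_slot_relations[OF free.kspace_axioms N _ _ that[unfolded tensor2_null_def]])
      (auto simp: tensor3_relations)
  have g0: "?g y w \<in> tensor3_null" if "w \<in> tensor2_null" for w y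
    using slot[OF that] by simp
  have g1: "?g (y + y') w - ?g y w - ?g y' w \<in> tensor3_null" for y y' w
    unfolding free.free_extend_fun_diff[symmetric]
    by (rule free.free_extend_mem[OF N]) (auto simp: tensor3_relations)
  have g2: "?g (scale c y) w - free_scale c (?g y w) \<in> tensor3_null" for c y w
    unfolding free.free_extend_fun_diff[symmetric] free.free_extend_fun_scale[symmetric]
    by (rule free.free_extend_mem[OF N]) (auto simp: tensor3_relations)
  have D_eq: "tensor2 (d x) = D x" if "\<And>x. d x \<in> D x" for d x
    using D that[of x] mem_tensor2D unfolding tensor2_linear_def by (metis imageE)
  have d1: "d (x + y) - d x - d y \<in> tensor2_null" for x y
    using D by (simp add: tensor2_linear_def D_eq[OF d, symmetric] tensor2_add tensor2_eq_iff diff_diff_eq)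
  have d2: "d (scale c x) - free_scale c (d x) \<in> tensor2_null" for c x
    using D by (simp add: tensor2_linear_def D_eq[OF d, symmetric] tensor2_scale tensor2_eq_iff)
  have g3: "?g y (d (x + x')) - ?g y (d x) - ?g y (d x') \<in> tensor3_null" for x x' y
    using g0[OF d1] by (simp only: free.free_extend_diff)
  have g4: "?g y (d (scale c x)) - free_scale c (?g y (d x)) \<in> tensor3_null" for c x y
    using g0[OF d2] by (simp only: free.free_extend_diff free.free_extend_scale)
  have 1: "left_extend d w \<in> tensor3_null" if "w \<in> tensor2_null" for w
    unfolding left_extend_def
    by (rule free_extend_slot_relations[OF free.kspace_axioms N _ _ that[unfolded tensor2_null_def]])
      (auto simp: g1 g2 g3 g4)
  have 2: "left_extend d' v - left_extend d v \<in> tensor3_null" if d': "\<And>x. d' x \<in> D x" for d' v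
  proof -
    have "d' x - d x \<in> tensor2_null" for x
      using D_eq[OF d, of x] D_eq[OF d', of x] by (simp add: tensor2_eq_iff[symmetric])
    then show ?thesis
      unfolding left_extend_def free.free_extend_fun_diff[symmetric]
      by (intro free.free_extend_mem[OF N])
        (auto simp: g0 simp flip: free.free_extend_diff)
  qed
  have "tensor3 (left_extend d' v) = tensor3 (left_extend d u)"
    if "v \<in> tensor2 u" and "\<And>x. d' x \<in> D x" for v d'
  proof -
    have "(left_extend d' v - left_extend d v) + left_extend d (v - u) \<in> tensor3_null"
      using 2[OF that(2)] 1[of "v - u"] that(1) N
      by (intro free.subspace_add[OF N]) (auto simp: tensor2_def)
    then show ?thesis
      by (simp add: tensor3_eq_iff left_extend_def free.free_extend_diff)
  qed
  then show ?thesis unfolding tensor_id_right_def using tensor2_self[of u] d by blast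
qed

lemma tensor_id_left:
  assumes D: "tensor2_linear D" and d: "\<And>x. d x \<in> D x"
  shows "tensor_id_left D (tensor2 u) = tensor3 (right_extend d u)"
proof -
  let ?g = "\<lambda>x. free_extend free_scale (\<lambda>(p, q). gen (x, p, q))"
  have N: "free.subspace tensor3_null" by (simp add: tensor3_null_def)
  have slot: "free_extend free_scale (\<lambda>(p, q). gen (y, p, q)) w \<in> tensor3_null" if "w \<in> tensor2_null" for w y
    by (rule free_extend_slot_relations[OF free.kspace_axioms N _ _ that[unfolded tensor2_null_def]])
      (auto simp: tensor3_relations)
  have g0: "?g y w \<in> tensor3_null" if "w \<in> tensor2_null" for w y
    using slot[OF that] by simp
  have g1: "?g (y + y') w - ?g y w - ?g y' w \<in> tensor3_null" for y y' w
    unfolding free.free_extend_fun_diff[symmetric]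
    by (rule free.free_extend_mem[OF N]) (auto simp: tensor3_relations)
  have g2: "?g (scale c y) w - free_scale c (?g y w) \<in> tensor3_null" for c y w
    unfolding free.free_extend_fun_diff[symmetric] free.free_extend_fun_scale[symmetric]
    by (rule free.free_extend_mem[OF N]) (auto simp: tensor3_relations)
  have D_eq: "tensor2 (d x) = D x" if "\<And>x. d x \<in> D x" for d x
    using D that[of x] mem_tensor2D unfolding tensor2_linear_def by (metis imageE)
  have d1: "d (x + y) - d x - d y \<in> tensor2_null" for x y
    using D by (simp add: tensor2_linear_def D_eq[OF d, symmetric] tensor2_add tensor2_eq_iff diff_diff_eq)
  have d2: "d (scale c x) - free_scale c (d x) \<in> tensor2_null" for c x
    using D by (simp add: tensor2_linear_def D_eq[OF d, symmetric] tensor2_scale tensor2_eq_iff)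
  have g3: "?g y (d (x + x')) - ?g y (d x) - ?g y (d x') \<in> tensor3_null" for x x' y
    using g0[OF d1] by (simp only: free.free_extend_diff)
  have g4: "?g y (d (scale c x)) - free_scale c (?g y (d x)) \<in> tensor3_null" for c x y
    using g0[OF d2] by (simp only: free.free_extend_diff free.free_extend_scale)
  have 1: "right_extend d w \<in> tensor3_null" if "w \<in> tensor2_null" for w
    unfolding right_extend_def
    by (rule free_extend_slot_relations[OF free.kspace_axioms N _ _ that[unfolded tensor2_null_def]])
      (auto simp: g1 g2 g3 g4)
  have 2: "right_extend d' v - right_extend d v \<in> tensor3_null" if d': "\<And>x. d' x \<in> D x" for d' v
  proof -
    have "d' x - d x \<in> tensor2_null" for x
      using D_eq[OF d, of x] D_eq[OF d', of x] by (simp add: tensor2_eq_iff[symmetric])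
    then show ?thesis
      unfolding right_extend_def free.free_extend_fun_diff[symmetric]
      by (intro free.free_extend_mem[OF N])
        (auto simp: g0 simp flip: free.free_extend_diff)
  qed
  have "tensor3 (right_extend d' v) = tensor3 (right_extend d u)"
    if "v \<in> tensor2 u" and "\<And>x. d' x \<in> D x" for v d'
  proof -
    have "(right_extend d' v - right_extend d v) + right_extend d (v - u) \<in> tensor3_null"
      using 2[OF that(2)] 1[of "v - u"] that(1) N
      by (intro free.subspace_add[OF N]) (auto simp: tensor2_def)
    then show ?thesis
      by (simp add: tensor3_eq_iff right_extend_def free.free_extend_diff)
  qed
  then show ?thesis unfolding tensor_id_left_def using tensor2_self[of u] d by blast
qed

end


section \<open>Hopf algebras\<close>

locale unital_algebra = kspace scale
  for scale :: "'k::field \<Rightarrow> 'h::ring_1 \<Rightarrow> 'h" +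
  assumes scale_mult_left: "scale c x * y = scale c (x * y)"
    and scale_mult_right: "x * scale c y = scale c (x * y)"
begin

definition free_mult ::
    "('h \<times> 'h \<Rightarrow>\<^sub>0 'k) \<Rightarrow> ('h \<times> 'h \<Rightarrow>\<^sub>0 'k) \<Rightarrow> ('h \<times> 'h \<Rightarrow>\<^sub>0 'k)" where
  "free_mult u v = free_extend free_scale
     (\<lambda>(x, y). free_extend free_scale (\<lambda>(x', y'). gen (x * x', y * y')) v) u"

definition tensor2_mult ::
    "('h \<times> 'h \<Rightarrow>\<^sub>0 'k) set \<Rightarrow> ('h \<times> 'h \<Rightarrow>\<^sub>0 'k) set \<Rightarrow> ('h \<times> 'h \<Rightarrow>\<^sub>0 'k) set" where
  "tensor2_mult A B = (\<Union>u\<in>A. \<Union>v\<in>B. tensor2 (free_mult u v))"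

lemma tensor2_mult: "tensor2_mult (tensor2 u) (tensor2 v) = tensor2 (free_mult u v)"
proof -
  let ?g = "\<lambda>x y. free_extend free_scale (\<lambda>(x', y'). gen (x * x', y * y'))"
  have N: "free.subspace tensor2_null" by (simp add: tensor2_null_def)
  have 1: "free_mult u w \<in> tensor2_null" if "w \<in> tensor2_null" for u w
  proof -
    have "?g x y w \<in> tensor2_null" for x y
      by (rule free_extend_slot_relations[OF free.kspace_axioms N _ _ that[unfolded tensor2_null_def]])
        (auto simp: tensor2_relations distrib_left scale_mult_right)
    then show ?thesis unfolding free_mult_def
      by (intro free.free_extend_mem[OF N]) auto
  qed
  have 2: "free_mult w v \<in> tensor2_null" if "w \<in> tensor2_null" for v w
    unfolding free_mult_def
    by (rule free_extend_slot_relations[OF free.kspace_axioms N _ _ that[unfolded tensor2_null_def]])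
      (auto simp: tensor2_relations distrib_right scale_mult_left
        simp flip: free.free_extend_fun_diff free.free_extend_fun_scale
        intro!: free.free_extend_mem[OF N])
  have diff: "free_mult (u' - u) w = free_mult u' w - free_mult u w"
    "free_mult w (u' - u) = free_mult w u' - free_mult w u" for u' u w
    by (simp_all add: free_mult_def free.free_extend_diff case_prod_unfold free.free_extend_fun_diff)
  have "tensor2 (free_mult u' v') = tensor2 (free_mult u v)"
    if "u' \<in> tensor2 u" "v' \<in> tensor2 v" for u' v'
  proof -
    have "free_mult (u' - u) v' + free_mult u (v' - v) \<in> tensor2_null"
      using that 1[of "v' - v" u] 2[of "u' - u" v']
      by (intro free.subspace_add[OF N]) (auto simp: tensor2_def)
    then show ?thesis by (simp add: tensor2_eq_iff diff)
  qed
  then show ?thesis unfolding tensor2_mult_def using tensor2_self by blast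
qed

end

locale bialgebra = unital_algebra scale
  for scale :: "'k::field \<Rightarrow> 'h::ring_1 \<Rightarrow> 'h" +
  fixes \<Delta> :: "'h \<Rightarrow> ('h \<times> 'h \<Rightarrow>\<^sub>0 'k) set"
    and \<epsilon> :: "'h \<Rightarrow> 'k"
  assumes comult_linear: "tensor2_linear \<Delta>"
    and counit_linear: "Vector_Spaces.linear scale (*) \<epsilon>"
    and coassoc: "tensor_id_right \<Delta> (\<Delta> x) = tensor_id_left \<Delta> (\<Delta> x)"
    and counit_left: "tensor2_lift (\<lambda>a b. scale (\<epsilon> a) b) (\<Delta> x) = x"
    and counit_right: "tensor2_lift (\<lambda>a b. scale (\<epsilon> b) a) (\<Delta> x) = x"
    and comult_mult: "\<Delta> (x * y) = tensor2_mult (\<Delta> x) (\<Delta> y)"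
    and comult_one: "\<Delta> 1 = tensor2 (gen (1, 1))"
    and counit_mult: "\<epsilon> (x * y) = \<epsilon> x * \<epsilon> y"
    and counit_one: "\<epsilon> 1 = 1"

locale hopf_algebra = bialgebra scale \<Delta> \<epsilon>
  for scale :: "'k::field \<Rightarrow> 'h::ring_1 \<Rightarrow> 'h" and \<Delta> \<epsilon> +
  fixes S :: "'h \<Rightarrow> 'h"
  assumes antipode_linear: "Vector_Spaces.linear scale scale S"
    and antipode_left: "tensor2_lift (\<lambda>a b. S a * b) (\<Delta> x) = scale (\<epsilon> x) 1"
    and antipode_right: "tensor2_lift (\<lambda>a b. a * S b) (\<Delta> x) = scale (\<epsilon> x) 1"

locale graded_connected_hopf_algebra = hopf_algebra scale \<Delta> \<epsilon> S
  for scale :: "'k::field \<Rightarrow> 'h::ring_1 \<Rightarrow> 'h" and \<Delta> \<epsilon> S +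
  fixes H :: "nat \<Rightarrow> 'h set"
  assumes subspace_H: "subspace (H m)"
    and direct_sum: "\<exists>!h. finite {m. h m \<noteq> 0} \<and> (\<forall>m. h m \<in> H m) \<and> x = (\<Sum>m | h m \<noteq> 0. h m)"
    and mult_H: "x \<in> H p \<Longrightarrow> y \<in> H q \<Longrightarrow> x * y \<in> H (p + q)"
    and comult_H: "x \<in> H m \<Longrightarrow>
      \<Delta> x \<in> tensor2 ` free.span {gen (a, b) | a b. \<exists>p q. p + q = m \<and> a \<in> H p \<and> b \<in> H q}"
    and one_H: "1 \<in> H 0"
    and counit_H: "m > 0 \<Longrightarrow> x \<in> H m \<Longrightarrow> \<epsilon> x = 0"
    and connected: "dim (H 0) = 1"


section \<open>Eigenvalues as roots of characteristic polynomials\<close>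

context kspace
begin

definition finite_dim :: "'v set \<Rightarrow> bool" where
  "finite_dim V \<longleftrightarrow> (\<exists>B. finite B \<and> span B = V)"

definition basis_list :: "'v list \<Rightarrow> 'v set \<Rightarrow> bool" where
  "basis_list bs V \<longleftrightarrow> distinct bs \<and> independent (set bs) \<and> span (set bs) = V"

definition matrix_in :: "'v list \<Rightarrow> ('v \<Rightarrow> 'v) \<Rightarrow> 'k mat" where
  "matrix_in bs f = mat (length bs) (length bs)
     (\<lambda>(i, j). representation (set bs) (f (bs ! j)) (bs ! i))"

text \<open>
  Roots are taken in the algebraic closure of the base field. The characteristic polynomial of an
  endomorphism of \<open>V\<close> does not depend on the basis used to compute it. The definition is meant
  for \<open>f\<close> mapping \<open>V\<close> to itself; \<open>representation\<close> is zero outside the span.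
\<close>

definition eigenvalue_on :: "'v set \<Rightarrow> ('v \<Rightarrow> 'v) \<Rightarrow> 'k alg_closure \<Rightarrow> bool" where
  "eigenvalue_on V f l \<longleftrightarrow>
     (\<exists>bs. basis_list bs V \<and> poly (map_poly to_ac (char_poly (matrix_in bs f))) l = 0)"

end

end

theory Submission
  imports Defs
begin

text \<open>
  On each component \<open>H m\<close> the map \<open>dev = id - S\<^sup>2\<close> is nilpotent. An eigenvalue \<open>l\<close> of \<open>S\<close> on
  \<open>H m\<close> therefore satisfies \<open>(1 - l\<^sup>2)^n = 0\<close> for some \<open>n\<close>, so that \<open>l = 1\<close> or \<open>l = -1\<close>.

  Nilpotency comes from two properties of the antipode. First, \<open>S\<close> reverses products
  (\<open>antipode_mult\<close>), so \<open>S\<^sup>2\<close> is multiplicative and \<open>dev\<close> is a skew derivation: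
  \<open>dev (x * y) = dev x * y + S\<^sup>2 x * dev y\<close>. Second, connectedness forces the coproduct of \<open>x \<in> H m\<close>
  with \<open>m > 0\<close> to be \<open>x \<otimes> 1 + 1 \<otimes> x\<close> up to terms both of whose factors have positive degree, so the
  antipode axiom gives \<open>S x \<equiv> -x\<close> modulo the span of the products of two elements of positive degree
  (\<open>antipode_add_self_decomposable\<close>). Applying this twice, \<open>dev x\<close> lies in that span.

  By induction on \<open>m\<close> the power \<open>dev^m\<close> vanishes on \<open>H m\<close> for \<open>m > 0\<close> (\<open>dev_pow_H\<close>): as
  \<open>dev x\<close> is a sum of products \<open>a * b\<close> of degrees \<open>p + q = m\<close> with \<open>p, q > 0\<close>, and \<open>dev^p a = 0\<close> and
  \<open>dev^q b = 0\<close>, the Leibniz rule gives \<open>dev^(m - 1) (a * b) = 0\<close>: in each term of the expansion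
  either at least \<open>p\<close> factors \<open>dev\<close> fall on \<open>a\<close> or at least \<open>q\<close> fall on \<open>b\<close>.

  This argument uses products rather than coproducts to filter \<open>H\<close>. The tensor squares and cubes
  enter only in the proof that \<open>S\<close> reverses products and in the reduction of the antipode axiom to
  homogeneous tensors; both are phrased as Sweedler sums with values in \<open>H\<close>.
\<close>

section \<open>Sums over the legs of a coproduct\<close>

context kspace
begin

abbreviation lin :: "('v \<Rightarrow> 'v) \<Rightarrow> bool" where
  "lin f \<equiv> Vector_Spaces.linear scale scale f"

lemma lin_iff:
  "lin f \<longleftrightarrow> (\<forall>x y. f (x + y) = f x + f y) \<and> (\<forall>c x. f (scale c x) = scale c (f x))"
  by (auto simp: Vector_Spaces.linear_iff vector_space_axioms)

lemma lin_add: "lin f \<Longrightarrow> f (x + y) = f x + f y"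
  and lin_scale: "lin f \<Longrightarrow> f (scale c x) = scale c (f x)"
  by (simp_all add: lin_iff)

lemma lin_diff: "lin f \<Longrightarrow> f (x - y) = f x - f y"
  using lin_add[of f "x - y" y] by (simp add: algebra_simps)

lemma lin_zero: "lin f \<Longrightarrow> f 0 = 0"
  using lin_add[of f 0 0] by simp

lemma lin_sum: "lin f \<Longrightarrow> f (sum g A) = (\<Sum>x\<in>A. f (g x))"
  by (induction A rule: infinite_finite_induct) (simp_all add: lin_zero lin_add)

lemma free_extend_free_extend:
  "free_extend scale f (free_extend free_scale g u) = free_extend scale (\<lambda>x. free_extend scale f (g x)) u"
proof -
  have "free_extend scale f (\<Sum>x\<in>A. h x) = (\<Sum>x\<in>A. free_extend scale f (h x))" for A :: "'b set" and h
    by (induction A rule: infinite_finite_induct) (simp_all add: free_extend_add)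
  then show ?thesis
    by (simp add: free_extend_def[of free_scale] free_extend_def[of _ _ u] free_extend_scale)
qed

lemma lin_free_extend: "lin h \<Longrightarrow> h (free_extend scale f u) = free_extend scale (\<lambda>x. h (f x)) u"
  by (simp add: free_extend_def lin_sum lin_scale)

lemma free_extend_fun_add:
  "free_extend scale (\<lambda>x. f x + g x) u = free_extend scale f u + free_extend scale g u"
  by (simp add: free_extend_def scale_right_distrib sum.distrib)

lemma free_extend_commute:
  "free_extend scale (\<lambda>a. free_extend scale (\<lambda>b. f a b) u) v =
   free_extend scale (\<lambda>b. free_extend scale (\<lambda>a. f a b) v) u"
  by (simp add: free_extend_def scale_sum_right sum.swap[of _ "Poly_Mapping.keys v"] mult.commute)

lemma free_extend_span_mem:
  assumes N: "subspace N" and u: "u \<in> free.span {gen x | x. P x}" and f: "\<And>x. P x \<Longrightarrow> f x \<in> N"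
  shows "free_extend scale f u \<in> N"
  using u
proof (induction rule: free.span_induct_alt)
  case base
  then show ?case using N by (simp add: subspace_0)
next
  case (step c x y)
  then show ?case
    using N f by (auto simp: free_extend_add free_extend_scale subspace_add subspace_scale)
qed

text \<open>
  The universal property of the tensor cube: a trilinear map respects the defining relations.
\<close>

lemma free_extend_tensor3_null:
  assumes "\<And>y z. lin (\<lambda>x. T x y z)" "\<And>x z. lin (\<lambda>y. T x y z)" "\<And>x y. lin (\<lambda>z. T x y z)"
    and w: "w \<in> tensor3_null"
  shows "free_extend scale (\<lambda>(x, y, z). T x y z) w = 0"
proof -
  have "free_extend scale (\<lambda>(x, y, z). T x y z) w \<in> {0}"
    by (rule free_extend_slot_relations[OF kspace_axioms subspace_single_0 _ _
          w[unfolded tensor3_null_def]])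
      (auto simp: lin_add[OF assms(1)] lin_add[OF assms(2)] lin_add[OF assms(3)]
        lin_scale[OF assms(1)] lin_scale[OF assms(2)] lin_scale[OF assms(3)])
  then show ?thesis by simp
qed

end

context bialgebra
begin

text \<open>
  Sweedler sums \<open>\<Sum> \<beta> x\<^sub>1 x\<^sub>2\<close> are taken over a fixed representative of \<open>\<Delta> x\<close> and hence make sense for
  arbitrary \<open>\<beta>\<close>. For bilinear \<open>\<beta>\<close> any other representative may be used instead, by
  \<open>sweedler_eq_free_extend\<close>.
\<close>

definition coproduct_rep :: "'h \<Rightarrow> 'h \<times> 'h \<Rightarrow>\<^sub>0 'k" where
  "coproduct_rep x = (SOME u. u \<in> \<Delta> x)"

definition sweedler :: "('h \<Rightarrow> 'h \<Rightarrow> 'h) \<Rightarrow> 'h \<Rightarrow> 'h" where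
  "sweedler \<beta> x = free_extend scale (\<lambda>(a, b). \<beta> a b) (coproduct_rep x)"

lemma coproduct_rep: "coproduct_rep x \<in> \<Delta> x"
proof -
  obtain u where "\<Delta> x = tensor2 u"
    using comult_linear unfolding tensor2_linear_def by blast
  then show ?thesis unfolding coproduct_rep_def using tensor2_self[of u] by (metis someI)
qed

lemma comult_eq_tensor2: "\<Delta> x = tensor2 (coproduct_rep x)"
  using comult_linear coproduct_rep[of x] mem_tensor2D unfolding tensor2_linear_def
  by (metis imageE)

lemma tensor2_lift_comult:
  assumes "\<And>b. lin (\<lambda>a. \<beta> a b)" "\<And>a. lin (\<beta> a)"
  shows "tensor2_lift \<beta> (\<Delta> x) = sweedler \<beta> x"
  using tensor2_lift[of \<beta>] assms by (simp add: comult_eq_tensor2 sweedler_def)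

lemma sweedler_eq_free_extend:
  assumes "\<And>b. lin (\<lambda>a. \<beta> a b)" "\<And>a. lin (\<beta> a)" and "\<Delta> x = tensor2 u"
  shows "sweedler \<beta> x = free_extend scale (\<lambda>(a, b). \<beta> a b) u"
  using tensor2_lift_comult[of \<beta> x] tensor2_lift[of \<beta> u] assms by simp

lemma lin_sweedler_fun:
  assumes "\<And>a b. lin (\<lambda>x. \<beta> x a b)"
  shows "lin (\<lambda>x. sweedler (\<beta> x) y)"
  unfolding lin_iff sweedler_def
  by (simp add: lin_add[OF assms] lin_scale[OF assms] case_prod_unfold
      free_extend_fun_add free_extend_fun_scale)

lemma lin_out_of_sweedler: "lin f \<Longrightarrow> sweedler (\<lambda>a b. f (\<beta> a b)) x = f (sweedler \<beta> x)"
  by (simp add: sweedler_def lin_free_extend case_prod_unfold)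

lemma sweedler_commute:
  "sweedler (\<lambda>a b. sweedler (\<lambda>c d. \<beta> a b c d) y) x = sweedler (\<lambda>c d. sweedler (\<lambda>a b. \<beta> a b c d) x) y"
  unfolding sweedler_def case_prod_unfold by (rule free_extend_commute)

text \<open>
  Both sides evaluate \<open>T\<close> on a representative of an element of the tensor cube, and these two elements
  agree by coassociativity. The left-hand side splits the first leg again, the right-hand side the
  second.
\<close>

lemma sweedler_coassoc:
  assumes "\<And>y z. lin (\<lambda>x. T x y z)" "\<And>x z. lin (\<lambda>y. T x y z)" "\<And>x y. lin (\<lambda>z. T x y z)"
  shows "sweedler (\<lambda>a b. sweedler (\<lambda>p q. T p q b) a) x = sweedler (\<lambda>a b. sweedler (\<lambda>p q. T a p q) b) x"
proof -
  let ?T = "\<lambda>(x, y, z). T x y z"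
  have "tensor3 (left_extend coproduct_rep (coproduct_rep x)) =
        tensor3 (right_extend coproduct_rep (coproduct_rep x))"
    using coassoc[of x] tensor_id_right[OF comult_linear coproduct_rep]
      tensor_id_left[OF comult_linear coproduct_rep] by (simp add: comult_eq_tensor2[of x])
  then have "free_extend scale ?T (left_extend coproduct_rep (coproduct_rep x) -
      right_extend coproduct_rep (coproduct_rep x)) = 0"
    by (intro free_extend_tensor3_null assms) (simp add: tensor3_eq_iff)
  then show ?thesis
    by (simp add: free_extend_diff left_extend_def right_extend_def free_extend_free_extend
        sweedler_def case_prod_unfold)
qed

lemma sweedler_mult:
  assumes "\<And>b. lin (\<lambda>a. \<beta> a b)" "\<And>a. lin (\<beta> a)"
  shows "sweedler \<beta> (x * y) = sweedler (\<lambda>a b. sweedler (\<lambda>c d. \<beta> (a * c) (b * d)) y) x"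
proof -
  have "\<Delta> (x * y) = tensor2 (free_mult (coproduct_rep x) (coproduct_rep y))"
    by (simp add: comult_mult comult_eq_tensor2[of x] comult_eq_tensor2[of y] tensor2_mult)
  from sweedler_eq_free_extend[OF assms this] show ?thesis
    by (simp add: free_mult_def free_extend_free_extend sweedler_def case_prod_unfold)
qed

lemma counit_add: "\<epsilon> (x + y) = \<epsilon> x + \<epsilon> y"
  and counit_scale: "\<epsilon> (scale c x) = c * \<epsilon> x"
  using counit_linear by (simp_all add: Vector_Spaces.linear_iff)

lemma lin_ident: "lin (\<lambda>x. x)"
  and lin_mult_const: "lin f \<Longrightarrow> lin (\<lambda>x. f x * y)"
  and lin_const_mult: "lin f \<Longrightarrow> lin (\<lambda>x. y * f x)"
  and lin_scale_const: "lin f \<Longrightarrow> lin (\<lambda>x. scale c (f x))"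
  and lin_counit: "lin (\<lambda>x. scale (\<epsilon> x) y)"
  by (simp_all add: lin_iff distrib_left distrib_right scale_mult_left scale_mult_right
      counit_add counit_scale scale_left_distrib scale_right_distrib mult.commute)

lemmas lin_intros = lin_ident lin_mult_const lin_const_mult lin_counit lin_scale_const

lemma sweedler_counit_left: "sweedler (\<lambda>a b. scale (\<epsilon> a) b) x = x"
  using counit_left[of x] by (subst (asm) tensor2_lift_comult) (intro lin_intros)+

lemma sweedler_counit_right: "sweedler (\<lambda>a b. scale (\<epsilon> b) a) x = x"
  using counit_right[of x] by (subst (asm) tensor2_lift_comult) (intro lin_intros)+

lemma sweedler_counit_left_lin: "lin f \<Longrightarrow> sweedler (\<lambda>a b. scale (\<epsilon> a) (f b)) x = f x"
  using lin_out_of_sweedler[of f "\<lambda>a b. scale (\<epsilon> a) b" x] by (simp add: sweedler_counit_left lin_scale)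

lemma sweedler_counit_right_lin: "lin f \<Longrightarrow> sweedler (\<lambda>a b. scale (\<epsilon> b) (f a)) x = f x"
  using lin_out_of_sweedler[of f "\<lambda>a b. scale (\<epsilon> b) a" x] by (simp add: sweedler_counit_right lin_scale)

end

section \<open>The antipode reverses products\<close>

context hopf_algebra
begin

lemma lin_antipode: "lin f \<Longrightarrow> lin (\<lambda>x. S (f x))"
  using antipode_linear by (simp add: lin_iff)

lemmas lin_hopf_intros = lin_intros lin_antipode

lemma sweedler_antipode_left: "sweedler (\<lambda>a b. S a * b) x = scale (\<epsilon> x) 1"
  using antipode_left[of x] by (subst (asm) tensor2_lift_comult) (intro lin_hopf_intros)+

lemma sweedler_antipode_right: "sweedler (\<lambda>a b. a * S b) x = scale (\<epsilon> x) 1"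
  using antipode_right[of x] by (subst (asm) tensor2_lift_comult) (intro lin_hopf_intros)+

text \<open>
  On \<open>H \<otimes> H\<close> the map \<open>x \<otimes> y \<mapsto> S (x * y)\<close> is a left convolution inverse of the product, and
  \<open>x \<otimes> y \<mapsto> S y * S x\<close> is a right one; so the two agree. In Sweedler notation this evaluates
  \<open>\<Sum> S (x\<^sub>1 y\<^sub>1) x\<^sub>2 y\<^sub>2 S y\<^sub>3 S x\<^sub>3\<close> in two ways, contracting either the last four factors or the
  first three.
\<close>

lemma antipode_mult: "S (x * y) = S y * S x"
proof -
  define K where "K = (\<lambda>a b c p q r. S (a * p) * ((b * q) * (S r * S c)))"
  have linK:
    "lin (\<lambda>a. K a b c p q r)" "lin (\<lambda>b. K a b c p q r)" "lin (\<lambda>c. K a b c p q r)"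
    "lin (\<lambda>p. K a b c p q r)" "lin (\<lambda>q. K a b c p q r)" "lin (\<lambda>r. K a b c p q r)"
    for a b c p q r
    unfolding K_def by (intro lin_hopf_intros)+
  \<comment> \<open>The split legs are the second ones, so \<open>K\<close> receives \<open>x\<^sub>1, x\<^sub>2, x\<^sub>3, y\<^sub>1, y\<^sub>2, y\<^sub>3\<close>.\<close>
  let ?P = "sweedler (\<lambda>a x'. sweedler (\<lambda>b c. sweedler (\<lambda>p y'. sweedler (\<lambda>q r. K a b c p q r) y') y) x') x"
  have "?P = S (x * y)"
  proof -
    \<comment> \<open>From inside out: \<open>y\<^sub>2 S y\<^sub>3\<close> collapses to a counit, which removes a leg of \<open>y\<close>; the same then happens to \<open>x\<close>.\<close>
    have 1: "sweedler (\<lambda>q r. K a b c p q r) y' = scale (\<epsilon> y') (S (a * p) * (b * S c))" for a b c p y'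
    proof -
      have "sweedler (\<lambda>q r. (\<lambda>z. S (a * p) * (b * (z * S c))) (q * S r)) y' =
          (\<lambda>z. S (a * p) * (b * (z * S c))) (sweedler (\<lambda>q r. q * S r) y')"
        by (intro lin_out_of_sweedler lin_hopf_intros)
      then show ?thesis
        by (simp add: K_def sweedler_antipode_right scale_mult_left scale_mult_right mult.assoc)
    qed
    have 2: "sweedler (\<lambda>p y'. scale (\<epsilon> y') (S (a * p) * (b * S c))) y = S (a * y) * (b * S c)" for a b c
      by (rule sweedler_counit_right_lin) (intro lin_hopf_intros)
    have 3: "sweedler (\<lambda>b c. S (a * y) * (b * S c)) x' = scale (\<epsilon> x') (S (a * y))" for a x'
    proof -
      have "sweedler (\<lambda>b c. (\<lambda>z. S (a * y) * z) (b * S c)) x' =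
          (\<lambda>z. S (a * y) * z) (sweedler (\<lambda>b c. b * S c) x')"
        by (intro lin_out_of_sweedler lin_hopf_intros)
      then show ?thesis
        by (simp add: sweedler_antipode_right scale_mult_right)
    qed
    have 4: "sweedler (\<lambda>a x'. scale (\<epsilon> x') (S (a * y))) x = S (x * y)"
      by (rule sweedler_counit_right_lin) (intro lin_hopf_intros)
    show ?thesis unfolding 1 2 3 4 ..
  qed
  moreover have "?P = S y * S x"
  proof -
    \<comment> \<open>Coassociativity moves the second splitting to the first legs, for \<open>y\<close> and then for \<open>x\<close>.\<close>
    have "?P = sweedler (\<lambda>a x'. sweedler (\<lambda>b c. sweedler (\<lambda>y' r. sweedler (\<lambda>p q. K a b c p q r) y') y) x') x"
      by (subst sweedler_coassoc) (rule linK refl)+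
    also have "\<dots> = sweedler (\<lambda>x' c. sweedler (\<lambda>a b. sweedler (\<lambda>y' r. sweedler (\<lambda>p q. K a b c p q r) y') y) x') x"
      by (subst sweedler_coassoc) (rule linK lin_sweedler_fun refl)+
    also have "\<dots> = sweedler (\<lambda>x' c. sweedler (\<lambda>y' r. sweedler (\<lambda>a b. sweedler (\<lambda>p q. K a b c p q r) y') x') y) x"
      by (subst sweedler_commute) (rule refl)
    also have "\<dots> = S y * S x"
    proof -
      \<comment> \<open>The two inner sums together form one sum over the coproduct of the product of the first legs.\<close>
      have 1: "sweedler (\<lambda>a b. sweedler (\<lambda>p q. K a b c p q r) y') x' =
          scale (\<epsilon> x') (scale (\<epsilon> y') (S r * S c))" for c r x' y'
      proof -
        have "sweedler (\<lambda>u v. S u * (v * (S r * S c))) (x' * y') =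
            sweedler (\<lambda>a b. sweedler (\<lambda>p q. K a b c p q r) y') x'"
          unfolding K_def by (rule sweedler_mult) (intro lin_hopf_intros)+
        moreover have "sweedler (\<lambda>u v. (\<lambda>z. z * (S r * S c)) (S u * v)) (x' * y') =
            (\<lambda>z. z * (S r * S c)) (sweedler (\<lambda>u v. S u * v) (x' * y'))"
          by (intro lin_out_of_sweedler lin_hopf_intros)
        ultimately show ?thesis
          by (simp add: sweedler_antipode_left scale_mult_left counit_mult mult.assoc)
      qed
      have 2: "sweedler (\<lambda>y' r. scale (\<epsilon> x') (scale (\<epsilon> y') (S r * S c))) y = scale (\<epsilon> x') (S y * S c)" for x' c
        by (subst lin_out_of_sweedler, intro lin_intros, subst sweedler_counit_left_lin)
          (intro lin_hopf_intros refl)+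
      have 3: "sweedler (\<lambda>x' c. scale (\<epsilon> x') (S y * S c)) x = S y * S x"
        by (rule sweedler_counit_left_lin) (intro lin_hopf_intros)
      show ?thesis unfolding 1 2 3 ..
    qed
    finally show ?thesis .
  qed
  ultimately show ?thesis by simp
qed

end

section \<open>Nilpotency of the deviation of the square of the antipode from the identity\<close>

context graded_connected_hopf_algebra
begin

definition dev :: "'h \<Rightarrow> 'h" where
  "dev x = x - S (S x)"

definition decomposables :: "nat \<Rightarrow> 'h set" where
  "decomposables m = span {a * b | a b. \<exists>p q. 0 < p \<and> 0 < q \<and> p + q = m \<and> a \<in> H p \<and> b \<in> H q}"

lemma subspace_decomposables: "subspace (decomposables m)"
  by (simp add: decomposables_def)

lemma decomposablesI: "0 < p \<Longrightarrow> 0 < q \<Longrightarrow> a \<in> H p \<Longrightarrow> b \<in> H q \<Longrightarrow> a * b \<in> decomposables (p + q)"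
  unfolding decomposables_def by (blast intro: span_base)

text \<open>
  Connectedness: \<open>H 0\<close> is the line spanned by \<open>1\<close>, and the counit reads off the coordinate.
\<close>

lemma H0_scalar:
  assumes "x \<in> H 0"
  shows "x = scale (\<epsilon> x) 1"
proof -
  obtain B where B: "B \<subseteq> H 0" "independent B" "H 0 \<subseteq> span B" "card B = 1"
    using basis_exists[of "H 0"] connected by auto
  then obtain b where b: "B = {b}" by (auto simp: card_1_singleton_iff)
  have "1 \<in> span {b}" "x \<in> span {b}"
    using B(3) b one_H assms by auto
  then obtain c c' where c: "1 = scale c b" "x = scale c' b"
    unfolding span_singleton by blast
  then have "c \<noteq> 0" by auto
  then have "x = scale (c' / c) (scale c b)" using c(2) by simp
  then have "x = scale (c' / c) 1" by (simp only: c(1))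
  then obtain c where "x = scale c 1" by blast
  then show ?thesis by (simp add: counit_scale counit_one)
qed

lemma antipode_one: "S 1 = 1"
proof -
  have "S 1 * 1 = scale (\<epsilon> 1) 1"
    using sweedler_eq_free_extend[OF _ _ comult_one, of "\<lambda>a b. S a * b"] sweedler_antipode_left[of 1]
    by (simp add: lin_hopf_intros lin_antipode[OF lin_ident])
  then show ?thesis by (simp add: counit_one)
qed

text \<open>
  The coproduct of a homogeneous element is represented by homogeneous tensors, so for bilinear \<open>\<beta>\<close> a
  membership of the Sweedler sum needs to be checked only on those.
\<close>

lemma sweedler_mem:
  assumes x: "x \<in> H m" and N: "subspace N"
    and lin: "\<And>b. lin (\<lambda>a. \<beta> a b)" "\<And>a. lin (\<beta> a)"
    and mem: "\<And>p q a b. p + q = m \<Longrightarrow> a \<in> H p \<Longrightarrow> b \<in> H q \<Longrightarrow> \<beta> a b \<in> N"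
  shows "sweedler \<beta> x \<in> N"
proof -
  from comult_H[OF x] obtain u where u: "\<Delta> x = tensor2 u"
    "u \<in> free.span {gen z | z. \<exists>a b p q. z = (a, b) \<and> p + q = m \<and> a \<in> H p \<and> b \<in> H q}"
    by (smt (verit, best) Collect_cong imageE)
  have "free_extend scale (\<lambda>(a, b). \<beta> a b) u \<in> N"
    by (rule free_extend_span_mem[OF N u(2)]) (auto intro: mem)
  then show ?thesis using sweedler_eq_free_extend[OF lin u(1)] by simp
qed

lemma lin_diffI: "lin f \<Longrightarrow> lin g \<Longrightarrow> lin (\<lambda>x. f x - g x)"
  by (simp add: lin_iff scale_right_diff_distrib)

lemma sweedler_diff: "sweedler (\<lambda>a b. \<beta> a b - \<gamma> a b) x = sweedler \<beta> x - sweedler \<gamma> x"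
  by (simp add: sweedler_def case_prod_unfold free_extend_fun_diff)

text \<open>
  The terms of \<open>\<Sum> S x\<^sub>1 * x\<^sub>2 = \<epsilon> x\<close> whose second factor has degree \<open>0\<close> add up to \<open>S x\<close>, by the counit
  axiom; in all others the first factor has smaller degree. Subtracting \<open>\<Sum> \<epsilon> x\<^sub>2 S x\<^sub>1 = S x\<close> inside the sum
  removes the former without naming them, which leaves terms covered by the induction hypothesis.
\<close>

lemma antipode_H: "x \<in> H m \<Longrightarrow> S x \<in> H m"
proof (induction m arbitrary: x rule: less_induct)
  case (less m)
  let ?\<beta> = "\<lambda>a b. S a * b - scale (\<epsilon> b) (S a)"
  have "sweedler ?\<beta> x \<in> H m"
  proof (rule sweedler_mem[OF less.prems subspace_H])
    fix p q a b assume *: "p + q = m" "a \<in> H p" "b \<in> H q"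
    show "?\<beta> a b \<in> H m"
    proof (cases "q = 0")
      case True
      then have "?\<beta> a b = 0"
        using * H0_scalar[of b] scale_mult_right[of "S a" "\<epsilon> b" 1] by simp
      then show ?thesis by (simp add: subspace_0[OF subspace_H])
    next
      case False
      with * less.IH[of p a] counit_H[of q b] mult_H[of "S a" p b q] show ?thesis by simp
    qed
  qed (intro lin_hopf_intros lin_diffI)+
  moreover have "sweedler ?\<beta> x = scale (\<epsilon> x) 1 - S x"
    using sweedler_counit_right_lin[of S x] lin_antipode[OF lin_ident]
    by (simp add: sweedler_diff sweedler_antipode_left)
  moreover have "scale (\<epsilon> x) 1 \<in> H m"
    using counit_H[of m x] less.prems one_H subspace_scale[OF subspace_H] subspace_0[OF subspace_H]
    by (cases "m = 0") auto
  ultimately show ?case using subspace_diff[OF subspace_H, of "scale (\<epsilon> x) 1" m "scale (\<epsilon> x) 1 - S x"] by simp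
qed

text \<open>
  Subtracting both \<open>\<Sum> \<epsilon> x\<^sub>2 S x\<^sub>1 = S x\<close> and \<open>\<Sum> \<epsilon> x\<^sub>1 x\<^sub>2 = x\<close> from \<open>\<Sum> S x\<^sub>1 * x\<^sub>2 = 0\<close> cancels all terms with
  a factor of degree \<open>0\<close>, and the remaining ones are decomposable.
\<close>

lemma antipode_add_self_decomposable:
  assumes x: "x \<in> H m" and m: "0 < m"
  shows "S x + x \<in> decomposables m"
proof -
  let ?\<beta> = "\<lambda>a b. S a * b - scale (\<epsilon> b) (S a) - scale (\<epsilon> a) b"
  have "sweedler ?\<beta> x \<in> decomposables m"
  proof (rule sweedler_mem[OF x subspace_decomposables])
    fix p q a b assume *: "p + q = m" "a \<in> H p" "b \<in> H q"
    consider "p = 0" "q \<noteq> 0" | "q = 0" "p \<noteq> 0" | "p \<noteq> 0" "q \<noteq> 0" using * m by auto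
    then show "?\<beta> a b \<in> decomposables m"
    proof cases
      case 1
      have "S a = scale (\<epsilon> a) 1"
        using H0_scalar[of a] * 1 lin_scale[OF antipode_linear, of "\<epsilon> a" 1] by (simp add: antipode_one)
      then show ?thesis
        using 1 * counit_H[of q b] by (simp add: scale_mult_left subspace_0[OF subspace_decomposables])
    next
      case 2
      then have "?\<beta> a b = 0"
        using * H0_scalar[of b] scale_mult_right[of "S a" "\<epsilon> b" 1] counit_H[of p a] by simp
      then show ?thesis by (simp add: subspace_0[OF subspace_decomposables])
    next
      case 3
      then show ?thesis
        using * counit_H[of p a] counit_H[of q b] decomposablesI[of p q "S a" b] antipode_H by simp
    qed
  qed (intro lin_hopf_intros lin_diffI)+
  moreover have "sweedler ?\<beta> x = - (S x + x)"
    using sweedler_counit_right_lin[of S x] lin_antipode[OF lin_ident] counit_H[OF m x]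
    by (simp add: sweedler_diff sweedler_antipode_left sweedler_counit_left)
  ultimately show ?thesis using subspace_neg[OF subspace_decomposables, of "- (S x + x)" m] by (simp add: add.commute)
qed

lemma lin_dev: "lin dev"
  unfolding dev_def by (intro lin_diffI lin_hopf_intros)

lemma lin_dev_pow: "lin (dev ^^ n)"
  using lin_dev by (induction n) (simp_all add: lin_iff)

lemma dev_decomposable:
  assumes x: "x \<in> H m" and m: "0 < m"
  shows "dev x \<in> decomposables m"
proof -
  \<comment> \<open>As \<open>S x\<close> again has degree \<open>m\<close>, the congruence \<open>S z \<equiv> -z\<close> applies to it as well.\<close>
  have "(S x + x) - (S (S x) + S x) \<in> decomposables m"
    by (intro subspace_diff[OF subspace_decomposables] antipode_add_self_decomposable m x antipode_H)
  then show ?thesis by (simp add: dev_def)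
qed

lemma dev_mult: "dev (x * y) = dev x * y + S (S x) * dev y"
  by (simp add: dev_def antipode_mult algebra_simps)

lemma dev_pow_antipode_square: "(dev ^^ n) (S (S x)) = S (S ((dev ^^ n) x))"
  by (induction n) (simp_all add: dev_def lin_diff[OF antipode_linear])

text \<open>
  By the skew Leibniz rule \<open>dev_mult\<close>, each application of \<open>dev\<close> to a product uses up one unit of
  \<open>a + b\<close>. The twist by \<open>S\<^sup>2\<close> is harmless because \<open>S\<^sup>2\<close> commutes with \<open>dev\<close> and so preserves the
  kernels of its powers.
\<close>

lemma dev_pow_mult_zero:
  assumes "(dev ^^ a) x = 0" "(dev ^^ b) y = 0" "a + b \<le> Suc n"
  shows "(dev ^^ n) (x * y) = 0"
  using assms
proof (induction n arbitrary: a b x y)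
  case 0
  then have "a = 0 \<or> b = 0" by auto
  then show ?case using 0 by auto
next
  case (Suc n)
  show ?case
  proof (cases "a = 0 \<or> b = 0")
    case True
    then show ?thesis using Suc.prems lin_zero[OF lin_dev_pow] lin_zero[OF lin_dev] by (auto simp: funpow_swap1)
  next
    case False
    then obtain a' b' where ab: "a = Suc a'" "b = Suc b'" by (metis not0_implies_Suc)
    have "(dev ^^ a') (dev x) = 0" "(dev ^^ b') (dev y) = 0"
      using Suc.prems ab by (simp_all add: funpow_swap1)
    moreover have "(dev ^^ a) (S (S x)) = 0"
      using Suc.prems(1) by (simp only: dev_pow_antipode_square) (simp add: lin_zero[OF antipode_linear])
    ultimately have "(dev ^^ n) (dev x * y) = 0" "(dev ^^ n) (S (S x) * dev y) = 0"
      using Suc.prems ab by (auto intro: Suc.IH[of a' _ b] Suc.IH[of a _ b'])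
    then show ?thesis
      by (simp add: funpow_swap1 dev_mult lin_add[OF lin_dev_pow])
  qed
qed

lemma dev_pow_H: "0 < m \<Longrightarrow> x \<in> H m \<Longrightarrow> (dev ^^ m) x = 0"
proof (induction m arbitrary: x rule: less_induct)
  case (less m)
  have ker: "subspace {z. (dev ^^ (m - 1)) z = 0}"
    by (auto simp: subspace_def lin_add[OF lin_dev_pow] lin_scale[OF lin_dev_pow] lin_zero[OF lin_dev_pow])
  have "decomposables m \<subseteq> {z. (dev ^^ (m - 1)) z = 0}"
    unfolding decomposables_def
  proof (rule span_minimal[OF _ ker], clarify)
    fix a b p q assume *: "0 < p" "0 < q" "m = p + q" "a \<in> H p" "b \<in> H q"
    show "(dev ^^ (p + q - 1)) (a * b) = 0"
      by (rule dev_pow_mult_zero[OF less.IH less.IH]) (use * in auto)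
  qed
  with dev_decomposable[OF less.prems(2,1)] have "(dev ^^ (m - 1)) (dev x) = 0" by auto
  moreover have "(dev ^^ m) x = (dev ^^ (m - 1)) (dev x)"
    using less.prems(1) by (cases m) (simp_all add: funpow_swap1)
  ultimately show ?case by simp
qed

text \<open>
  The exponent \<open>Suc m\<close> covers \<open>m = 0\<close>, where \<open>dev\<close> itself is zero.
\<close>

lemma dev_nilpotent_on_H: "x \<in> H m \<Longrightarrow> (dev ^^ Suc m) x = 0"
proof (cases "m = 0")
  case True
  assume "x \<in> H m"
  then have "x = scale (\<epsilon> x) 1" using True H0_scalar by simp
  then have "S x = x" using lin_scale[OF antipode_linear, of "\<epsilon> x" 1] by (simp add: antipode_one)
  then show ?thesis by (simp add: True dev_def)
next
  case False
  assume "x \<in> H m"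
  then show ?thesis using dev_pow_H[of m x] False by (simp add: lin_zero[OF lin_dev])
qed

end

section \<open>From nilpotency to eigenvalues\<close>

interpretation to_ac: field_hom "to_ac :: 'k::field \<Rightarrow> 'k alg_closure"
  by unfold_locales simp_all

context kspace
begin

text \<open>
  The coordinate map \<open>k^d \<rightarrow> V\<close> of a basis; it intertwines the matrix of \<open>f\<close> with \<open>f\<close>, which transfers the
  nilpotency of \<open>id - f\<^sup>2\<close> to the matrix.
\<close>

definition combination :: "'v list \<Rightarrow> 'k vec \<Rightarrow> 'v" where
  "combination bs w = (\<Sum>i<length bs. scale (w $ i) (bs ! i))"

lemma combination_eq_0D:
  assumes bs: "basis_list bs V" and w: "w \<in> carrier_vec (length bs)" and 0: "combination bs w = 0"
  shows "w = 0\<^sub>v (length bs)"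
proof (rule eq_vecI)
  have bij: "bij_betw ((!) bs) {..<length bs} (set bs)"
    using bs by (intro bij_betw_nth) (auto simp: basis_list_def)
  let ?f = "\<lambda>v. w $ (the_inv_into {..<length bs} ((!) bs) v)"
  have inv: "the_inv_into {..<length bs} ((!) bs) (bs ! i) = i" if "i < length bs" for i
    using that bij by (intro the_inv_into_f_f) (auto simp: bij_betw_def)
  have "(\<Sum>v\<in>set bs. scale (?f v) v) = combination bs w"
    unfolding sum.reindex_bij_betw[OF bij, symmetric] combination_def by (simp add: inv)
  then have *: "?f v = 0" if "v \<in> set bs" for v
    using independentD[of "set bs" "set bs" ?f v] bs 0 that by (simp add: basis_list_def)
  fix i assume "i < dim_vec (0\<^sub>v (length bs) :: 'k vec)"
  then show "w $ i = 0\<^sub>v (length bs) $ i" using *[of "bs ! i"] inv[of i] by simp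
qed (use w in auto)

lemma combination_in: "basis_list bs V \<Longrightarrow> combination bs w \<in> V"
  unfolding combination_def basis_list_def
  by (auto intro!: span_sum intro!: span_scale intro: span_base)

lemma combination_matrix_in:
  assumes bs: "basis_list bs V" and f: "lin f" "\<And>x. x \<in> V \<Longrightarrow> f x \<in> V"
    and w: "w \<in> carrier_vec (length bs)"
  shows "combination bs (matrix_in bs f *\<^sub>v w) = f (combination bs w)"
proof -
  let ?n = "length bs" and ?r = "\<lambda>i j. representation (set bs) (f (bs ! j)) (bs ! i)"
  have bij: "bij_betw ((!) bs) {..<length bs} (set bs)"
    using bs by (intro bij_betw_nth) (auto simp: basis_list_def)
  have col: "(\<Sum>i<?n. scale (?r i j) (bs ! i)) = f (bs ! j)" if "j < ?n" for j
  proof -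
    have "f (bs ! j) \<in> span (set bs)"
      using f(2)[of "bs ! j"] bs that span_base[of "bs ! j" "set bs"] by (auto simp: basis_list_def)
    then have "(\<Sum>v\<in>set bs. scale (representation (set bs) (f (bs ! j)) v) v) = f (bs ! j)"
      using bs by (intro sum_representation_eq) (auto simp: basis_list_def)
    then show ?thesis unfolding sum.reindex_bij_betw[OF bij, symmetric] .
  qed
  have "combination bs (matrix_in bs f *\<^sub>v w) = (\<Sum>i<?n. \<Sum>j<?n. scale (w $ j) (scale (?r i j) (bs ! i)))"
    using w by (auto simp: combination_def matrix_in_def scalar_prod_def scale_sum_left lessThan_atLeast0
        mult.commute intro!: sum.cong)
  also have "\<dots> = (\<Sum>j<?n. scale (w $ j) (f (bs ! j)))"
    by (subst sum.swap) (auto intro!: sum.cong simp: scale_sum_right simp flip: col)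
  also have "\<dots> = f (combination bs w)"
    by (simp add: combination_def lin_sum[OF f(1)] lin_scale[OF f(1)])
  finally show ?thesis .
qed

text \<open>
  An eigenvalue lives in the algebraic closure, whereas \<open>V\<close> is a space over the base field. The relation
  \<open>(1 - M\<^sup>2)^n = 0\<close> for the matrix \<open>M\<close> of \<open>f\<close> can be transported along the field embedding, and is then
  applied to an eigenvector over the closure.
\<close>

lemma eigenvalue_on_square_unipotent:
  assumes f: "lin f" "\<And>x. x \<in> V \<Longrightarrow> f x \<in> V"
    and nil: "\<And>x. x \<in> V \<Longrightarrow> ((\<lambda>x. x - f (f x)) ^^ n) x = 0"
    and ev: "eigenvalue_on V f l"
  shows "l = 1 \<or> l = -1"
proof -
  from ev obtain bs where bs: "basis_list bs V"
    and root: "poly (map_poly to_ac (char_poly (matrix_in bs f))) l = 0"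
    by (auto simp: eigenvalue_on_def)
  define d where "d = length bs"
  define M where "M = matrix_in bs f"
  define A where "A = map_mat to_ac M"
  define E where "E = 1\<^sub>m d - M * M"
  have M: "M \<in> carrier_mat d d" by (simp add: M_def matrix_in_def d_def)
  have A: "A \<in> carrier_mat d d" using M by (simp add: A_def)
  have E: "E \<in> carrier_mat d d" unfolding E_def using M by (intro minus_carrier_mat mult_carrier_mat)
  have Epow: "E ^\<^sub>m k \<in> carrier_mat d d" for k using E by simp
  have comb_E: "combination bs (E *\<^sub>v w) = combination bs w - f (f (combination bs w))"
    if w: "w \<in> carrier_vec d" for w
  proof -
    have "E *\<^sub>v w = w - M *\<^sub>v (M *\<^sub>v w)"
      using M w by (simp add: E_def minus_mult_distrib_mat_vec[of _ d d] assoc_mult_mat_vec[of _ d d _ d])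
    moreover have "combination bs (w - w') = combination bs w - combination bs w'" if "w' \<in> carrier_vec d" for w'
      using w that by (simp add: combination_def d_def scale_left_diff_distrib sum_subtractf)
    moreover have "combination bs (M *\<^sub>v (M *\<^sub>v w)) = f (f (combination bs w))"
      using M w by (simp add: M_def d_def combination_matrix_in[OF bs f])
    ultimately show ?thesis using M w by simp
  qed
  have comb_pow: "combination bs (E ^\<^sub>m k *\<^sub>v w) = ((\<lambda>x. x - f (f x)) ^^ k) (combination bs w)"
    if "w \<in> carrier_vec d" for k w
    using that
  proof (induction k arbitrary: w)
    case 0
    then show ?case using E by simp
  next
    case (Suc k)
    have "E ^\<^sub>m Suc k *\<^sub>v w = E ^\<^sub>m k *\<^sub>v (E *\<^sub>v w)"
      using Suc.prems E Epow by (simp add: assoc_mult_mat_vec[of _ d d _ d])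
    then show ?case
      using Suc.IH[of "E *\<^sub>v w"] comb_E[OF Suc.prems] E Suc.prems
      by (simp add: funpow_Suc_right del: funpow.simps(2))
  qed
  have E0: "E ^\<^sub>m n = 0\<^sub>m d d"
  proof (rule eq_matI)
    fix i j assume ij: "i < dim_row (0\<^sub>m d d :: 'k mat)" "j < dim_col (0\<^sub>m d d :: 'k mat)"
    have "combination bs (E ^\<^sub>m n *\<^sub>v unit_vec d j) = 0"
      using comb_pow[of "unit_vec d j" n] nil[OF combination_in[OF bs]] by simp
    then have "E ^\<^sub>m n *\<^sub>v unit_vec d j = 0\<^sub>v d"
      using combination_eq_0D[OF bs] Epow[of n] unfolding d_def by (metis mult_mat_vec_carrier unit_vec_carrier)
    moreover have "(E ^\<^sub>m n *\<^sub>v unit_vec d j) $ i = (E ^\<^sub>m n) $$ (i, j)"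
      using carrier_matD[OF Epow[of n]] ij by simp
    ultimately show "(E ^\<^sub>m n) $$ (i, j) = 0\<^sub>m d d $$ (i, j)" using ij by simp
  qed (use Epow[of n] in auto)
  have "char_poly A = map_poly to_ac (char_poly M)"
    unfolding A_def by (rule to_ac.char_poly_hom[OF M])
  then have "eigenvalue A l"
    using root eigenvalue_root_char_poly[OF A] by (simp add: M_def)
  then obtain v where v: "v \<in> carrier_vec d" "v \<noteq> 0\<^sub>v d" "A *\<^sub>v v = l \<cdot>\<^sub>v v"
    using A by (auto simp: eigenvalue_def eigenvector_def)
  define F where "F = map_mat to_ac E"
  have F: "F \<in> carrier_mat d d" using E by (simp add: F_def)
  have "F = 1\<^sub>m d - A * A"
  proof -
    have "F = map_mat to_ac (1\<^sub>m d) - map_mat to_ac (M * M)"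
      using M by (intro eq_matI) (auto simp: F_def E_def simp del: index_mult_mat(1))
    then show ?thesis using M by (simp add: A_def to_ac.mat_hom_mult to_ac.mat_hom_one)
  qed
  then have "F *\<^sub>v v = v - (l * l) \<cdot>\<^sub>v v"
    using A v by (simp add: minus_mult_distrib_mat_vec[of _ d d] assoc_mult_mat_vec[of _ d d _ d]
        mult_mat_vec[of _ d d] smult_smult_assoc)
  also have "\<dots> = (1 - l * l) \<cdot>\<^sub>v v"
    using v(1) by (intro eq_vecI) (auto simp: algebra_simps)
  finally have "F *\<^sub>v v = (1 - l * l) \<cdot>\<^sub>v v" .
  then have Fpow: "F ^\<^sub>m k *\<^sub>v v = (1 - l * l) ^ k \<cdot>\<^sub>v v" for k
  proof (induction k)
    case 0
    then show ?case using F v by simp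
  next
    case (Suc k)
    have "F ^\<^sub>m Suc k *\<^sub>v v = F ^\<^sub>m k *\<^sub>v (F *\<^sub>v v)"
      using F v by (simp add: assoc_mult_mat_vec[of _ d d _ d])
    then show ?case
      using Suc F v by (simp add: mult_mat_vec[of _ d d] smult_smult_assoc)
  qed
  have "map_mat to_ac (0\<^sub>m d d :: 'k mat) = 0\<^sub>m d d" by (intro eq_matI) auto
  then have "F ^\<^sub>m n = 0\<^sub>m d d"
    unfolding F_def using to_ac.mat_hom_pow[OF E, of n] E0 by simp
  moreover have "0\<^sub>m d d *\<^sub>v v = 0\<^sub>v d" using v(1) by (intro eq_vecI) auto
  ultimately have "(1 - l * l) ^ n \<cdot>\<^sub>v v = 0\<^sub>v d" using Fpow[of n] by simp
  moreover obtain i where "i < d" "v $ i \<noteq> 0"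
    using v by (metis carrier_vecD eq_vecI index_zero_vec)
  ultimately have "(1 - l * l) ^ n = 0"
    using v by (metis carrier_vecD index_smult_vec(1) index_zero_vec(1) mult_eq_0_iff)
  then have "(1 - l) * (1 + l) = 0" by (simp add: algebra_simps)
  then show ?thesis by (auto simp: eq_neg_iff_add_eq_0 add.commute)
qed

end

theorem corollary5:
  fixes scale :: "'k::field_char_0 \<Rightarrow> 'h::ring_1 \<Rightarrow> 'h"
    and \<Delta> :: "'h \<Rightarrow> ('h \<times> 'h \<Rightarrow>\<^sub>0 'k) set"
    and \<epsilon> :: "'h \<Rightarrow> 'k"
    and S :: "'h \<Rightarrow> 'h"
    and H :: "nat \<Rightarrow> 'h set"
  assumes "graded_connected_hopf_algebra scale \<Delta> \<epsilon> S H"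
    and "\<And>m. kspace.finite_dim scale (H m)"
  shows "\<forall>m l. kspace.eigenvalue_on scale (H m) S l \<longrightarrow> l = 1 \<or> l = -1"
proof (intro allI impI)
  interpret graded_connected_hopf_algebra scale \<Delta> \<epsilon> S H by fact
  fix m l assume l: "eigenvalue_on (H m) S l"
  show "l = 1 \<or> l = -1"
  proof (rule eigenvalue_on_square_unipotent[OF antipode_linear antipode_H _ l])
    show "((\<lambda>x. x - S (S x)) ^^ Suc m) x = 0" if "x \<in> H m" for x
      using dev_nilpotent_on_H[OF that] by (simp add: dev_def[abs_def])
  qed
qed

end
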